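(* For $N\in\mathbb N$, $\theta\in[0,2\pi]$ and $r\in[0,1)$ let $K_N(\theta,r):=1+2\sum_{n=1}^N r^n\cos(n\theta)$. For every integer $N\ge 4$ one has $$K_N(\theta,r)\ge 0\quad\text{for all }\theta\in[0,2\pi]\text{ and all } r\in[0,1)\text{ with } r\le r_N^\ast,$$ where $$r_N^\ast:=\left(1-2\,\frac{\ln\big(2(N+1)\big)}{N+1}\right)^{1/2}.$$
   Context: $\ln$ denotes the natural logarithm. For $N\ge 4$ the quantity under the square root in $r_N^\ast$ is positive. *)

theory Defs
  imports Complex_Main
begin

definition K :: "nat \<Rightarrow> real \<Rightarrow> real \<Rightarrow> real" where
  "K N \<theta> r = 1 + 2 * (\<Sum>n=1..N. r ^ n * cos (real n * \<theta>))"

(* For N < 4 the radicand may be negative; sqrt is then an odd extension and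
   the value carries no meaning. *)
definition r_star :: "nat \<Rightarrow> real" where
  "r_star N = sqrt (1 - 2 * (ln (2 * (real N + 1)) / (real N + 1)))"

end

theory Submission
  imports Defs
begin

text \<open>
  Multiplying \<open>K N \<theta> r\<close> by \<open>\<bar>1 - r e\<^sup>i\<^sup>\<theta>\<bar>\<^sup>2\<close> telescopes the sum, and the result is at least
  \<open>(1 + r) (1 - r - 2 r\<^sup>M)\<close> with \<open>M = N + 1\<close>. Put \<open>L = ln (2 M)\<close>. If \<open>r\<^sup>2 \<le> 1 - 2 L / M\<close>, then
  \<open>r\<^sup>2 \<le> exp (-2 L / M)\<close>, so \<open>2 r\<^sup>M \<le> 2 exp (-L) = 1 / M\<close>, whereas
  \<open>1 - r \<ge> (1 - r\<^sup>2) / 2 \<ge> L / M \<ge> 1 / M\<close>.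
\<close>

lemma K_closed_form:
  "(1 - 2 * r * cos \<theta> + r\<^sup>2) * K N \<theta> r =
     1 - r\<^sup>2 - 2 * r ^ (N + 1) * cos (real (N + 1) * \<theta>) + 2 * r ^ (N + 2) * cos (real N * \<theta>)"
proof (induction N)
  case 0
  show ?case by (simp add: K_def power2_eq_square)
next
  case (Suc N)
  have split: "K (Suc N) \<theta> r = K N \<theta> r + 2 * r ^ (N + 1) * cos (real (N + 1) * \<theta>)"
    by (simp add: K_def algebra_simps)
  \<comment> \<open>Expanding both around the middle angle gives the three-term recurrence, which
    absorbs the product of cosines that the multiplier creates from the new summand.\<close>
  have "cos (real (N + 2) * \<theta>) = cos (real (N + 1) * \<theta> + \<theta>)"
    and "cos (real N * \<theta>) = cos (real (N + 1) * \<theta> - \<theta>)"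
    by (simp_all add: algebra_simps)
  then have rec: "cos (real (N + 2) * \<theta>) =
      2 * cos \<theta> * cos (real (N + 1) * \<theta>) - cos (real N * \<theta>)"
    by (simp only: cos_add cos_diff) (simp add: algebra_simps)
  have "(1 - 2 * r * cos \<theta> + r\<^sup>2) * K (Suc N) \<theta> r =
      1 - r\<^sup>2 - 2 * r ^ (N + 2) * cos (real (N + 2) * \<theta>) + 2 * r ^ (N + 3) * cos (real (N + 1) * \<theta>)"
    unfolding split distrib_left Suc.IH rec
    by (simp add: algebra_simps power_add power2_eq_square power3_eq_cube)
  then show ?case
    by (simp add: numeral_eq_Suc)
qed

lemma K_nonneg:
  assumes "0 \<le> r" "r < 1" and tail: "2 * r ^ (N + 1) \<le> 1 - r"
  shows "K N \<theta> r \<ge> 0"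
proof -
  \<comment> \<open>The multiplier is at least \<open>(1 - r)\<^sup>2\<close>, so its sign can be
    cancelled at the end.\<close>
  have "r * cos \<theta> \<le> r"
    using assms(1) by (simp add: mult_left_le)
  moreover have "(1 - r)\<^sup>2 > 0"
    using assms(2) by simp
  ultimately have pos: "1 - 2 * r * cos \<theta> + r\<^sup>2 > 0"
    by (simp add: power2_diff)
  have "r ^ (N + 1) * cos (real (N + 1) * \<theta>) \<le> r ^ (N + 1)"
    by (rule mult_left_le) (use assms(1) in auto)
  moreover have "r ^ (N + 2) * - cos (real N * \<theta>) \<le> r ^ (N + 2)"
    by (rule mult_left_le) (use assms(1) cos_ge_minus_one[of "real N * \<theta>"] in auto)
  \<comment> \<open>With each cosine at its worst sign, the closed form factors as this product;
    \<open>tail\<close> controls the second factor.\<close>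
  moreover have "0 \<le> (1 + r) * (1 - r - 2 * r ^ (N + 1))"
    using assms by simp
  then have "0 \<le> 1 - r\<^sup>2 - 2 * r ^ (N + 1) - 2 * r ^ (N + 2)"
    by (simp add: algebra_simps power2_eq_square)
  ultimately have "(1 - 2 * r * cos \<theta> + r\<^sup>2) * K N \<theta> r \<ge> 0"
    unfolding K_closed_form by linarith
  then show ?thesis
    using pos by (simp add: zero_le_mult_iff)
qed

lemma power_r_star_bound:
  assumes "N \<ge> 1" "0 \<le> r" "r < 1" "r \<le> r_star N"
  shows "2 * r ^ (N + 1) \<le> 1 - r"
proof -
  define M L where "M = real N + 1" and "L = ln (2 * M)"
  have M: "M \<ge> 2"
    using assms(1) by (simp add: M_def)
  \<comment> \<open>Here e <= 3 < 4 <= 2 M; the resulting L >= 1 is what later absorbs 1 / M into L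
    / M.\<close>
  have "exp 1 \<le> 2 * M"
    using M exp_le by linarith
  then have L: "L \<ge> 1"
    using M by (simp add: L_def ln_ge_iff)
  have r_le: "r \<le> sqrt (1 - 2 * (L / M))"
    using assms(4) by (simp add: r_star_def M_def L_def)
  \<comment> \<open>\<open>sqrt\<close> is negative on negative arguments, so r >= 0 forces the
    radicand to be nonnegative and the bound may be squared.\<close>
  then have "0 \<le> 1 - 2 * (L / M)"
    using assms(2) by (metis order_trans real_sqrt_ge_0_iff)
  then have sq: "r\<^sup>2 \<le> 1 - 2 * (L / M)"
    using power_mono[OF r_le assms(2), of 2] by simp
  also have "\<dots> \<le> exp (- 2 * (L / M))"
    using exp_ge_add_one_self[of "- 2 * (L / M)"] by simp
  also have "\<dots> = (exp (- (L / M)))\<^sup>2"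
    by (simp add: power2_eq_square flip: exp_add)
  finally have "r \<le> exp (- (L / M))"
    by (rule power2_le_imp_le) simp
  then have "r ^ (N + 1) \<le> exp (- (L / M)) ^ (N + 1)"
    using assms(2) by (rule power_mono)
  also have "\<dots> = exp (M * - (L / M))"
    using exp_of_nat_mult[of "N + 1" "- (L / M)"] by (simp add: M_def add.commute)
  also have "\<dots> = 1 / (2 * M)"
    using M by (simp add: L_def exp_minus inverse_eq_divide)
  finally have "2 * r ^ (N + 1) \<le> 1 / M"
    by simp
  also have "1 / M \<le> L / M"
    using L M by (simp add: divide_right_mono)
  \<comment> \<open>Expanding (1 - r)^2 >= 0 gives 1 - r >= (1 - r^2) / 2, and \<open>sq\<close>
    bounds the right side below by L / M.\<close>
  also have "L / M \<le> 1 - r"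
    using sq sum_power2_ge_zero[of "1 - r" 0] by (simp add: power2_diff)
  finally show ?thesis .
qed

theorem theorem5p2:
  fixes N :: nat
  assumes "N \<ge> 4"
  shows "\<forall>\<theta>\<in>{0..2 * pi}. \<forall>r\<in>{0..<1}. r \<le> r_star N \<longrightarrow> K N \<theta> r \<ge> 0"
  using assms by (auto intro!: K_nonneg power_r_star_bound)

end
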